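(* Let $R\ge1$, let $C\subseteq\mathbb{R}^2$ be a compact convex $R$-fat set, and let $S$ be the family of convex $2R$-fat subsets of $\mathbb{R}^2$. Then $\mathrm{PropEF}(C,2,S)=1/2$.
   Context: For $R\ge1$, a planar piece (Borel subset of $\mathbb{R}^2$) is $R$-fat if it contains a square $B^-$ and is contained in a square $B^+$ parallel to $B^-$ with $\mathrm{len}(B^+)/\mathrm{len}(B^-)\le R$ (len = side length). A value measure on $C$ is $V(X)=\int_X v$ with $v$ non-negative, bounded, integrable on $C$, $V(C)<\infty$; $V^S(X):=\sup\{V(s):s\in S,s\subseteq X\}$. For $n$ agents with value measures $V_1,\dots,V_n$, an $S$-allocation is $(X_1,\dots,X_n)$ with $X_i\in S$ pairwise disjoint and $\bigcup_i X_i\subseteq C$; it is envy-free if $V_i^S(X_i)\ge V_i^S(X_j)$ for all $i,j$. $\mathrm{PropEF}(C,n,S):=\inf_{V_1,\dots,V_n}\sup_X\min_i V_i(X_i)/V_i(C)$, the infimum over all $n$-tuples of value measures on $C$ and the supremum over envy-free $S$-allocations. *)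

theory Defs
  imports "HOL-Analysis.Analysis"
begin

type_synonym point = "real \<times> real"

definition square :: "real \<Rightarrow> point \<Rightarrow> real \<Rightarrow> point set" where
  "square \<theta> c s =
     (\<lambda>(x, y). (fst c + cos \<theta> * x - sin \<theta> * y, snd c + sin \<theta> * x + cos \<theta> * y))
       ` ({0..s} \<times> {0..s})"

definition fat :: "real \<Rightarrow> point set \<Rightarrow> bool" where
  "fat R X \<longleftrightarrow> X \<in> sets borel \<and>
     (\<exists>\<theta> c1 s1 c2 s2. 0 < s1 \<and> square \<theta> c1 s1 \<subseteq> X \<and> X \<subseteq> square \<theta> c2 s2
        \<and> s2 / s1 \<le> R)"

definition V :: "(point \<Rightarrow> real) \<Rightarrow> point set \<Rightarrow> real" where
  "V v X = (LINT x:X|lborel. v x)"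

definition value_density :: "point set \<Rightarrow> (point \<Rightarrow> real) \<Rightarrow> bool" where
  "value_density C v \<longleftrightarrow> set_integrable lborel C v \<and> (\<forall>x\<in>C. 0 \<le> v x)
     \<and> bounded (v ` C) \<and> 0 < V v C"

definition VS :: "point set set \<Rightarrow> (point \<Rightarrow> real) \<Rightarrow> point set \<Rightarrow> real" where
  "VS S v X = Sup {V v s | s. s \<in> S \<and> s \<subseteq> X}"

definition allocation :: "point set \<Rightarrow> nat \<Rightarrow> point set set \<Rightarrow> (nat \<Rightarrow> point set) \<Rightarrow> bool" where
  "allocation C n S X \<longleftrightarrow> (\<forall>i<n. X i \<in> S) \<and> (\<forall>i<n. \<forall>j<n. i \<noteq> j \<longrightarrow> X i \<inter> X j = {})
     \<and> (\<forall>i<n. X i \<subseteq> C)"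

definition envy_free :: "point set set \<Rightarrow> nat \<Rightarrow> (nat \<Rightarrow> point \<Rightarrow> real) \<Rightarrow> (nat \<Rightarrow> point set) \<Rightarrow> bool" where
  "envy_free S n v X \<longleftrightarrow> (\<forall>i<n. \<forall>j<n. VS S (v i) (X i) \<ge> VS S (v i) (X j))"

text \<open>PropEF(C,n,S), valued in the extended reals (Sup of the empty set is -infinity).\<close>
definition PropEF :: "point set \<Rightarrow> nat \<Rightarrow> point set set \<Rightarrow> ereal" where
  "PropEF C n S =
     (INF v \<in> {v. \<forall>i<n. value_density C (v i)}.
        SUP X \<in> {X. allocation C n S X \<and> envy_free S n v X}.
          ereal (Min ((\<lambda>i. V (v i) (X i) / V (v i) C) ` {..<n})))"

end

theory Submission
  imports Defs
begin

text \<open>The two closed halves cut off by a line share the line, and an open half need not contain a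
  closed square of the required size. So each half is contracted towards a point of its interior:
  this preserves fatness exactly, makes the two pieces disjoint, and costs arbitrarily little
  area.\<close>

section \<open>Contracted halves of a convex body: membership, disjointness, area\<close>

definition shrunk_half :: "'a::euclidean_space set \<Rightarrow> 'a \<Rightarrow> real \<Rightarrow> 'a \<Rightarrow> 'a set" where
  "shrunk_half C q d w =
     (\<lambda>z. (1 - d) *\<^sub>R z + d *\<^sub>R (q + w)) ` (C \<inter> {z. 0 \<le> (z - q) \<bullet> w})"

text \<open>Solving for the preimage under the contraction leaves two conditions that depend
  continuously on \<open>w\<close>. The half-space condition acquires the positive threshold
  \<open>d * (w \<bullet> w)\<close>, which keeps opposite pieces apart.\<close>

lemma mem_shrunk_half:
  assumes "d < 1"
  shows "x \<in> shrunk_half C q d w \<longleftrightarrow>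
    (1 / (1 - d)) *\<^sub>R (x - d *\<^sub>R (q + w)) \<in> C \<and> 0 \<le> (x - q) \<bullet> w - d * (w \<bullet> w)"
proof -
  define y where "y = (1 / (1 - d)) *\<^sub>R (x - d *\<^sub>R (q + w))"
  have eq: "x = (1 - d) *\<^sub>R z + d *\<^sub>R (q + w) \<longleftrightarrow> z = y" for z
    using assms by (auto simp: y_def)
  have "x = (1 - d) *\<^sub>R y + d *\<^sub>R (q + w)"
    by (simp add: eq)
  then have "x - q = (1 - d) *\<^sub>R (y - q) + d *\<^sub>R w"
    by (simp add: algebra_simps)
  then have "(x - q) \<bullet> w - d * (w \<bullet> w) = (1 - d) * ((y - q) \<bullet> w)"
    by (simp add: inner_add_left)
  then have "0 \<le> (x - q) \<bullet> w - d * (w \<bullet> w) \<longleftrightarrow> 0 \<le> (y - q) \<bullet> w"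
    using assms by (simp add: zero_le_mult_iff)
  then show ?thesis
    unfolding shrunk_half_def y_def[symmetric] by (auto simp: image_iff eq)
qed

lemma closed_halfspace_through: "closed {z::'a::euclidean_space. 0 \<le> (z - q) \<bullet> w}"
  by (intro closed_Collect_le continuous_intros)

lemma convex_halfspace_through: "convex {z::'a::euclidean_space. 0 \<le> (z - q) \<bullet> w}"
proof -
  have "{z. 0 \<le> (z - q) \<bullet> w} = {z. w \<bullet> z \<ge> w \<bullet> q}"
    by (auto simp: inner_diff_left inner_diff_right inner_commute)
  then show ?thesis
    by (simp add: convex_halfspace_ge)
qed

lemma compact_shrunk_half: "compact C \<Longrightarrow> compact (shrunk_half C q d w)"
  unfolding shrunk_half_def
  by (intro compact_continuous_image continuous_intros compact_Int_closed closed_halfspace_through)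

lemma convex_shrunk_half:
  assumes "convex C"
  shows "convex (shrunk_half C q d w)"
proof -
  have "shrunk_half C q d w = (\<lambda>z. d *\<^sub>R (q + w) + (1 - d) *\<^sub>R z) ` (C \<inter> {z. 0 \<le> (z - q) \<bullet> w})"
    by (simp add: shrunk_half_def add.commute)
  then show ?thesis
    by (simp add: convex_affinity convex_Int assms convex_halfspace_through)
qed

text \<open>Each point is a convex combination of a point of \<open>C\<close> and the centre
  \<open>q + w\<close> of the contraction.\<close>

lemma shrunk_half_subset:
  assumes "convex C" "q + w \<in> C" "0 \<le> d" "d \<le> 1"
  shows "shrunk_half C q d w \<subseteq> C"
  using assms by (auto simp: shrunk_half_def intro!: convexD)

text \<open>A common point would have an inner product with \<open>w\<close>, measured from
  \<open>q\<close>, that is at least \<open>d * (w \<bullet> w)\<close> and at most its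
  negative.\<close>

lemma disjoint_shrunk_half:
  assumes "w \<noteq> 0" "0 < d" "d < 1"
  shows "shrunk_half C q d w \<inter> shrunk_half C q d (- w) = {}"
proof -
  have pos: "0 < d * (w \<bullet> w)" using assms by simp
  have "0 \<le> (x - q) \<bullet> w - d * (w \<bullet> w)" "0 \<le> - ((x - q) \<bullet> w) - d * (w \<bullet> w)"
    if "x \<in> shrunk_half C q d w" "x \<in> shrunk_half C q d (- w)" for x
    using that assms by (simp_all add: mem_shrunk_half)
  with pos show ?thesis by fastforce
qed

lemma measure_shrunk_half:
  fixes C :: "'a::euclidean_space set"
  assumes "compact C" "d \<le> 1"
  shows "measure lborel (shrunk_half C q d w) =
    (1 - d) ^ DIM('a) * measure lborel (C \<inter> {z. 0 \<le> (z - q) \<bullet> w})"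
proof -
  let ?H = "C \<inter> {z. 0 \<le> (z - q) \<bullet> w}"
  have "compact ?H"
    using assms by (simp add: compact_Int_closed closed_halfspace_through)
  moreover have "measure lebesgue (shrunk_half C q d w) = (1 - d) ^ DIM('a) * measure lebesgue ?H"
    unfolding shrunk_half_def measure_lebesgue_affine using assms by simp
  ultimately show ?thesis
    using compact_shrunk_half[OF assms(1), of q d w] by (simp add: borel_compact)
qed

text \<open>The two closed halves before contraction cover \<open>C\<close>, and each contraction
  multiplies volume by the same power of \<open>1 - d\<close>.\<close>

lemma measure_two_shrunk_halves_ge:
  fixes C :: "'a::euclidean_space set"
  assumes C: "compact C" and d: "d \<le> 1"
  shows "(1 - d) ^ DIM('a) * measure lborel C
    \<le> measure lborel (shrunk_half C q d w) + measure lborel (shrunk_half C q d (- w))"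
proof -
  let ?H = "\<lambda>w. C \<inter> {z. 0 \<le> (z - q) \<bullet> w}"
  have H: "compact (?H w)" for w
    using C by (simp add: compact_Int_closed closed_halfspace_through)
  have "C = ?H w \<union> ?H (- w)" by auto
  then have "measure lborel C \<le> measure lborel (?H w) + measure lborel (?H (- w))"
    using H by (metis borel_compact measure_Un_le sets_lborel)
  then have "(1 - d) ^ DIM('a) * measure lborel C
    \<le> (1 - d) ^ DIM('a) * (measure lborel (?H w) + measure lborel (?H (- w)))"
    using d by (intro mult_left_mono) auto
  then show ?thesis
    using C d by (simp add: measure_shrunk_half algebra_simps)
qed

section \<open>Null sets and continuity of the value of a piece in the cutting direction\<close>

text \<open>Lebesgue measure is the completion of \<open>lborel\<close>, so even a negligible set
  that is not Borel is avoided almost everywhere.\<close>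

lemma AE_lborel_not_in_negligible:
  "negligible N \<Longrightarrow> AE x in lborel. x \<notin> N"
  using AE_completion_iff[of "\<lambda>x. x \<notin> N" lborel] AE_not_in[of N lebesgue]
  by (simp add: negligible_iff_null_sets)

lemma negligible_affine_image:
  assumes "negligible S" "compact S"
  shows "negligible ((\<lambda>x. r *\<^sub>R x + d) ` S)"
proof -
  have "compact ((\<lambda>x. r *\<^sub>R x + d) ` S)"
    by (intro compact_continuous_image continuous_intros assms)
  moreover have "measure lebesgue ((\<lambda>x. r *\<^sub>R x + d) ` S) = 0"
    unfolding measure_lebesgue_affine using assms by (simp add: negligible_imp_measure0)
  ultimately show ?thesis
    by (simp add: negligible_iff_measure lmeasurable_compact)
qed

text \<open>Dominated convergence: off the null set formed by the cutting hyperplane and the boundary of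
  the shrunk body, membership in the piece is locally constant in the cutting direction.\<close>
lemma continuous_on_integral_shrunk_half:
  fixes C :: "'a::euclidean_space set" and v :: "'a \<Rightarrow> real"
  assumes C: "compact C" "convex C" and d: "0 \<le> d" "d < 1" and v: "set_integrable lborel C v"
  shows "continuous_on {w. w \<noteq> 0 \<and> q + w \<in> C} (\<lambda>w. LINT x:shrunk_half C q d w|lborel. v x)"
  unfolding continuous_on_sequentially comp_def
proof (intro allI ballI impI, elim conjE)
  fix W :: "nat \<Rightarrow> 'a" and a
  assume W: "\<forall>n. W n \<in> {w. w \<noteq> 0 \<and> q + w \<in> C}" and a: "a \<in> {w. w \<noteq> 0 \<and> q + w \<in> C}"
    and lim: "W \<longlonglongrightarrow> a"
  let ?P = "shrunk_half C q d"
  define y where "y w x = (1 / (1 - d)) *\<^sub>R (x - d *\<^sub>R (q + w))" for w x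
  define N where "N = (\<lambda>z. (1 - d) *\<^sub>R z + d *\<^sub>R (q + a)) ` frontier C
    \<union> {x. a \<bullet> x = a \<bullet> q + d * (a \<bullet> a)}"
  \<comment> \<open>Convexity makes the frontier of \<open>C\<close> null, and \<open>a\<close>
    being nonzero makes the second set a genuine hyperplane.\<close>
  have "negligible N"
    unfolding N_def using a C
    by (intro negligible_Un negligible_affine_image negligible_convex_frontier
        negligible_hyperplane compact_frontier) auto
  then have AE_N: "AE x in lborel. x \<notin> N"
    by (rule AE_lborel_not_in_negligible)
  have ev: "\<forall>\<^sub>F n in sequentially. indicat_real (?P (W n)) x = indicator (?P a) x" if "x \<notin> N" for x
  proof -
    have *: "(\<lambda>n. y (W n) x) \<longlonglongrightarrow> y a x"
      unfolding y_def by (intro tendsto_intros lim)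
    have "x = (1 - d) *\<^sub>R y a x + d *\<^sub>R (q + a)"
      using d by (simp add: y_def)
    with that have "y a x \<notin> frontier C"
      unfolding N_def by blast
    \<comment> \<open>Both alternatives are open conditions, so the convergent preimages
      \<open>y (W n) x\<close> eventually satisfy the same one.\<close>
    then have "y a x \<in> interior C \<or> y a x \<in> - C"
      using C closure_closed[of C] by (auto simp: frontier_def compact_imp_closed)
    then have 1: "\<forall>\<^sub>F n in sequentially. (y (W n) x \<in> C) = (y a x \<in> C)"
    proof
      assume i: "y a x \<in> interior C"
      then have "\<forall>\<^sub>F n in sequentially. y (W n) x \<in> interior C"
        using topological_tendstoD[OF *] by blast
      then show ?thesis
        by eventually_elim (use i interior_subset in auto)
    next
      assume i: "y a x \<in> - C"
      then have "\<forall>\<^sub>F n in sequentially. y (W n) x \<in> - C"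
        using topological_tendstoD[OF *, of "- C"] C by (simp add: compact_imp_closed open_Compl)
      then show ?thesis
        by eventually_elim (use i in auto)
    qed
    let ?g = "\<lambda>w. (x - q) \<bullet> w - d * (w \<bullet> w)"
    have g: "(\<lambda>n. ?g (W n)) \<longlonglongrightarrow> ?g a"
      by (intro tendsto_intros lim)
    have "?g a \<noteq> 0"
      using that by (auto simp: N_def inner_diff_left inner_diff_right inner_commute)
    then have 2: "\<forall>\<^sub>F n in sequentially. (0 \<le> ?g (W n)) = (0 \<le> ?g a)"
    proof (cases "0 < ?g a")
      case True
      show ?thesis
        using order_tendstoD(1)[OF g True] by eventually_elim (use True in auto)
    next
      case False
      with \<open>?g a \<noteq> 0\<close> have neg: "?g a < 0" by simp
      show ?thesis
        using order_tendstoD(2)[OF g neg] by eventually_elim (use neg in auto)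
    qed
    show ?thesis
      using 1 2 by eventually_elim (use d in \<open>simp add: indicator_def mem_shrunk_half y_def\<close>)
  qed
  have int: "integrable lborel (\<lambda>x. indicator (?P w) x *\<^sub>R v x)" if "q + w \<in> C" for w
    using set_integrable_subset[OF v, of "?P w"] shrunk_half_subset[OF C(2) that, of d] d
      compact_shrunk_half[OF C(1)] by (simp add: set_integrable_def borel_compact)
  show "(\<lambda>n. LINT x:?P (W n)|lborel. v x) \<longlonglongrightarrow> (LINT x:?P a|lborel. v x)"
    unfolding set_lebesgue_integral_def
  proof (rule integral_dominated_convergence)
    show "integrable lborel (\<lambda>x. norm (indicator C x *\<^sub>R v x))"
      using v unfolding set_integrable_def by (rule integrable_norm)
    show "(\<lambda>x. indicator (?P a) x *\<^sub>R v x) \<in> borel_measurable lborel"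
      using int a by blast
    show "(\<lambda>x. indicator (?P (W i)) x *\<^sub>R v x) \<in> borel_measurable lborel" for i
      using int W by blast
    show "AE x in lborel. (\<lambda>i. indicator (?P (W i)) x *\<^sub>R v x) \<longlonglongrightarrow> indicator (?P a) x *\<^sub>R v x"
      using AE_N
    proof eventually_elim
      case (elim x)
      show ?case
        by (rule tendsto_eventually, use ev[OF elim] in eventually_elim) simp
    qed
    show "AE x in lborel. norm (indicator (?P (W i)) x *\<^sub>R v x) \<le> norm (indicator C x *\<^sub>R v x)" for i
      using shrunk_half_subset[OF C(2), of q "W i" d] W d
      by (intro AE_I2) (auto simp: indicator_def)
  qed
qed

section \<open>Squares, homotheties and fatness of the pieces\<close>

text \<open>In the rotated orthonormal frame, proving that a point lies in a square amounts to
  exhibiting two coordinates between 0 and \<open>s\<close>.\<close>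

lemma square_eq:
  "square \<theta> c s =
    {c + x *\<^sub>R (cos \<theta>, sin \<theta>) + y *\<^sub>R (- sin \<theta>, cos \<theta>) | x y. 0 \<le> x \<and> x \<le> s \<and> 0 \<le> y \<and> y \<le> s}"
proof -
  have "(fst c + cos \<theta> * x - sin \<theta> * y, snd c + sin \<theta> * x + cos \<theta> * y)
    = c + x *\<^sub>R (cos \<theta>, sin \<theta>) + y *\<^sub>R (- sin \<theta>, cos \<theta>)" for x y
    by (simp add: prod_eq_iff)
  moreover have "(\<lambda>(x, y). g x y) ` ({0..s} \<times> {0..s}) =
    {g x y | x y. 0 \<le> x \<and> x \<le> s \<and> 0 \<le> y \<and> y \<le> s}" for g :: "real \<Rightarrow> real \<Rightarrow> point"
    by force
  ultimately show ?thesis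
    unfolding square_def by (simp only:)
qed

text \<open>A positive factor preserves the directions of the sides and multiplies both coordinates
  by \<open>t\<close>; hence a contraction changes inner and outer squares in the same
  proportion.\<close>

lemma homothety_square:
  assumes "0 < t"
  shows "(\<lambda>z. t *\<^sub>R z + b) ` square \<theta> c s = square \<theta> (t *\<^sub>R c + b) (t * s)"
proof (intro set_eqI iffI)
  fix p assume "p \<in> (\<lambda>z. t *\<^sub>R z + b) ` square \<theta> c s"
  then obtain x y where "p = t *\<^sub>R (c + x *\<^sub>R (cos \<theta>, sin \<theta>) + y *\<^sub>R (- sin \<theta>, cos \<theta>)) + b"
    and *: "0 \<le> x" "x \<le> s" "0 \<le> y" "y \<le> s"
    unfolding square_eq by blast
  then have "p = (t *\<^sub>R c + b) + (t * x) *\<^sub>R (cos \<theta>, sin \<theta>) + (t * y) *\<^sub>R (- sin \<theta>, cos \<theta>)"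
    by (simp add: algebra_simps)
  with * assms show "p \<in> square \<theta> (t *\<^sub>R c + b) (t * s)"
    unfolding square_eq
    by (intro CollectI exI[of _ "t * x"] exI[of _ "t * y"]) simp
next
  fix p assume "p \<in> square \<theta> (t *\<^sub>R c + b) (t * s)"
  then obtain x y where p: "p = (t *\<^sub>R c + b) + x *\<^sub>R (cos \<theta>, sin \<theta>) + y *\<^sub>R (- sin \<theta>, cos \<theta>)"
    and *: "0 \<le> x" "x \<le> t * s" "0 \<le> y" "y \<le> t * s"
    unfolding square_eq by blast
  let ?z = "c + (x / t) *\<^sub>R (cos \<theta>, sin \<theta>) + (y / t) *\<^sub>R (- sin \<theta>, cos \<theta>)"
  have "?z \<in> square \<theta> c s"
    unfolding square_eq using * assms
    by (intro CollectI exI[of _ "x / t"] exI[of _ "y / t"]) (simp add: divide_simps mult.commute)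
  moreover have "p = t *\<^sub>R ?z + b"
    using assms p by (simp add: scaleR_add_right)
  ultimately show "p \<in> (\<lambda>z. t *\<^sub>R z + b) ` square \<theta> c s"
    by blast
qed

text \<open>Any line through the centre of the inner square leaves a whole quadrant of that square, a
  parallel square of half the side, on each side. The outer square is kept.\<close>
lemma fat_shrunk_half:
  fixes C :: "point set"
  assumes C: "compact C" "square \<theta> c1 s1 \<subseteq> C" "C \<subseteq> square \<theta> c2 s2"
    and s: "0 < s1" "s2 / s1 \<le> R" and d: "d < 1"
    and q: "q = c1 + (s1 / 2) *\<^sub>R (cos \<theta>, sin \<theta>) + (s1 / 2) *\<^sub>R (- sin \<theta>, cos \<theta>)"
  shows "fat (2 * R) (shrunk_half C q d w)"
proof -
  let ?e = "(cos \<theta>, sin \<theta>)" and ?f = "(- sin \<theta>, cos \<theta>)"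
  let ?h = "\<lambda>z. (1 - d) *\<^sub>R z + d *\<^sub>R (q + w)"
  \<comment> \<open>The signs of the inner products of \<open>w\<close> with the two axes select the
    quadrant: along each axis the offset from \<open>q\<close> then has the sign of that product, so
    both contributions to \<open>(p - q) \<bullet> w\<close> are nonnegative.\<close>
  define i where "i = (if 0 \<le> ?e \<bullet> w then s1 / 2 else 0)"
  define j where "j = (if 0 \<le> ?f \<bullet> w then s1 / 2 else 0)"
  define c where "c = c1 + i *\<^sub>R ?e + j *\<^sub>R ?f"
  have quadrant: "square \<theta> c (s1 / 2) \<subseteq> C \<inter> {z. 0 \<le> (z - q) \<bullet> w}"
  proof
    fix p assume "p \<in> square \<theta> c (s1 / 2)"
    then obtain x y where p: "p = c + x *\<^sub>R ?e + y *\<^sub>R ?f"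
      and xy: "0 \<le> x" "x \<le> s1 / 2" "0 \<le> y" "y \<le> s1 / 2"
      unfolding square_eq by blast
    have p1: "p = c1 + (i + x) *\<^sub>R ?e + (j + y) *\<^sub>R ?f"
      by (simp add: p c_def algebra_simps)
    have "p \<in> square \<theta> c1 s1"
      unfolding square_eq p1 using xy s
      by (intro CollectI exI[of _ "i + x"] exI[of _ "j + y"]) (auto simp: i_def j_def)
    have "p - q = (i + x - s1 / 2) *\<^sub>R ?e + (j + y - s1 / 2) *\<^sub>R ?f"
      by (simp add: p1 q algebra_simps)
    then have "(p - q) \<bullet> w = (i + x - s1 / 2) * (?e \<bullet> w) + (j + y - s1 / 2) * (?f \<bullet> w)"
      by (simp only: inner_add_left inner_scaleR_left)
    moreover have "0 \<le> (i + x - s1 / 2) * (?e \<bullet> w)"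
      using xy by (auto simp: i_def mult_nonpos_nonpos)
    moreover have "0 \<le> (j + y - s1 / 2) * (?f \<bullet> w)"
      using xy by (auto simp: j_def mult_nonpos_nonpos)
    ultimately have "0 \<le> (p - q) \<bullet> w" by linarith
    with \<open>p \<in> square \<theta> c1 s1\<close> C show "p \<in> C \<inter> {z. 0 \<le> (z - q) \<bullet> w}" by auto
  qed
  have "square \<theta> (?h c) ((1 - d) * (s1 / 2)) = ?h ` square \<theta> c (s1 / 2)"
    using d by (simp add: homothety_square)
  also have "\<dots> \<subseteq> shrunk_half C q d w"
    unfolding shrunk_half_def by (rule image_mono[OF quadrant])
  finally have inner: "square \<theta> (?h c) ((1 - d) * (s1 / 2)) \<subseteq> shrunk_half C q d w" .
  have "shrunk_half C q d w \<subseteq> ?h ` square \<theta> c2 s2"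
    unfolding shrunk_half_def using C by (intro image_mono) auto
  also have "\<dots> = square \<theta> (?h c2) ((1 - d) * s2)"
    using d by (simp add: homothety_square)
  finally have outer: "shrunk_half C q d w \<subseteq> square \<theta> (?h c2) ((1 - d) * s2)" .
  \<comment> \<open>The factor \<open>1 - d\<close> cancels; halving the inner side is what doubles
    the ratio.\<close>
  have "(1 - d) * s2 / ((1 - d) * (s1 / 2)) = 2 * (s2 / s1)"
    using d by simp
  also have "\<dots> \<le> 2 * R" using s by simp
  finally have "(1 - d) * s2 / ((1 - d) * (s1 / 2)) \<le> 2 * R" .
  moreover have "0 < (1 - d) * (s1 / 2)" using d s by simp
  moreover have "shrunk_half C q d w \<in> sets borel"
    using C compact_shrunk_half by (blast intro: borel_compact)
  ultimately show ?thesis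
    unfolding fat_def using inner outer by blast
qed

section \<open>Value measures and the value lost by contracting\<close>

lemma V_mono:
  assumes v: "value_density C v" and "A \<in> sets borel" "B \<in> sets borel" "A \<subseteq> B" "B \<subseteq> C"
  shows "V v A \<le> V v B"
proof -
  have i: "set_integrable lborel X v" if "X \<subseteq> C" "X \<in> sets borel" for X
    using v that set_integrable_subset[of lborel C v X] by (simp add: value_density_def)
  show ?thesis
    unfolding V_def set_lebesgue_integral_def
  proof (rule integral_mono)
    show "integrable lborel (\<lambda>x. indicator A x *\<^sub>R v x)" "integrable lborel (\<lambda>x. indicator B x *\<^sub>R v x)"
      using i assms by (auto simp: set_integrable_def)
    show "indicator A x *\<^sub>R v x \<le> indicator B x *\<^sub>R v x" for x
      using assms by (auto simp: indicator_def value_density_def)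
  qed
qed

lemma V_disjoint_Un:
  assumes "value_density C v" and "A \<in> sets borel" "B \<in> sets borel" "A \<union> B \<subseteq> C" "A \<inter> B = {}"
  shows "V v (A \<union> B) = V v A + V v B"
  unfolding V_def using assms set_integrable_subset[of lborel C v]
  by (intro set_integral_Un) (auto simp: value_density_def)

text \<open>By monotonicity a piece of \<open>S\<close> is its own best sub-piece, so the supremum
  is attained. Envy-freeness thus becomes a comparison of \<open>V\<close> on the pieces.\<close>

lemma VS_self:
  assumes "value_density C v" "S \<subseteq> sets borel" "X \<in> S" "X \<subseteq> C"
  shows "VS S v X = V v X"
  unfolding VS_def
  by (rule cSup_eq_maximum) (use assms in \<open>auto intro!: V_mono[of C]\<close>)

lemma V_le_bound_measure:
  assumes v: "value_density C v" and "compact C" and M: "\<And>x. x \<in> C \<Longrightarrow> v x \<le> M"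
    and A: "A \<in> sets borel" "A \<subseteq> C"
  shows "V v A \<le> M * measure lborel A"
proof -
  have "emeasure lborel A \<le> emeasure lborel C"
    using A \<open>compact C\<close> by (intro emeasure_mono) (auto simp: borel_compact)
  also have "\<dots> < \<infinity>"
    using emeasure_bounded_finite[OF compact_imp_bounded[OF \<open>compact C\<close>]] by simp
  finally have fin: "emeasure lborel A < \<infinity>" .
  have "V v A \<le> (LINT x:A|lborel. M)"
    unfolding V_def
  proof (rule set_integral_mono)
    show "set_integrable lborel A v"
      using v A set_integrable_subset[of lborel C v A] by (simp add: value_density_def)
    show "set_integrable lborel A (\<lambda>_. M)"
      unfolding set_integrable_def using A fin by simp
  qed (use M A in auto)
  also have "\<dots> = M * measure lborel A"
    using A fin by (subst set_integral_const) auto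
  finally show ?thesis .
qed


text \<open>The part of \<open>C\<close> outside both pieces has area at most
  \<open>1 - (1 - d)\<^sup>2\<close> times that of \<open>C\<close>, hence at most
  \<open>2 * d\<close> times it, and its value is at most \<open>M\<close> times its area.\<close>

lemma V_two_shrunk_halves_ge:
  fixes C :: "point set"
  assumes v: "value_density C v" and C: "compact C" "convex C"
    and w: "w \<noteq> 0" "q + w \<in> C" "q - w \<in> C" and d: "0 < d" "d < 1"
    and M: "0 \<le> M" "\<And>x. x \<in> C \<Longrightarrow> v x \<le> M"
  shows "V v C - 2 * d * (M * measure lborel C)
    \<le> V v (shrunk_half C q d w) + V v (shrunk_half C q d (- w))"
proof -
  let ?A = "shrunk_half C q d w" and ?B = "shrunk_half C q d (- w)"
  have meas: "?A \<in> sets borel" "?B \<in> sets borel" "C \<in> sets borel"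
    using C by (simp_all add: borel_compact compact_shrunk_half)
  have sub: "?A \<subseteq> C" "?B \<subseteq> C"
    using shrunk_half_subset[OF C(2), of q w d] shrunk_half_subset[OF C(2), of q "- w" d] w d
    by simp_all
  have disj: "?A \<inter> ?B = {}"
    using w d by (intro disjoint_shrunk_half)
  have fin: "emeasure lborel X \<noteq> \<infinity>" if "X \<subseteq> C" for X
    using C(1) that by (metis bounded_subset compact_imp_bounded emeasure_bounded_finite infinity_ennreal_def less_irrefl)
  have "V v C = V v (?A \<union> ?B) + V v (C - (?A \<union> ?B))"
    using V_disjoint_Un[OF v, of "?A \<union> ?B" "C - (?A \<union> ?B)"] meas sub
    by (simp add: Un_absorb1)
  also have "V v (?A \<union> ?B) = V v ?A + V v ?B"
    using V_disjoint_Un[OF v] meas sub disj by simp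
  finally have 1: "V v C = V v ?A + V v ?B + V v (C - (?A \<union> ?B))" .
  have "V v (C - (?A \<union> ?B)) \<le> M * measure lborel (C - (?A \<union> ?B))"
    using meas by (intro V_le_bound_measure[OF v C(1) M(2)]) auto
  also have "measure lborel (C - (?A \<union> ?B)) = measure lborel C - measure lborel (?A \<union> ?B)"
    using meas sub fin by (intro measure_Diff) auto
  also have "measure lborel (?A \<union> ?B) = measure lborel ?A + measure lborel ?B"
    using meas sub fin disj by (intro measure_Union) auto
  also have "M * (measure lborel C - (measure lborel ?A + measure lborel ?B))
    \<le> M * (2 * d * measure lborel C)"
  proof (intro mult_left_mono M)
    have "(1 - 2 * d) * measure lborel C \<le> (1 - d)\<^sup>2 * measure lborel C"
      by (intro mult_right_mono) (auto simp: power2_eq_square algebra_simps)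
    also have "\<dots> \<le> measure lborel ?A + measure lborel ?B"
      using measure_two_shrunk_halves_ge[OF C(1), of d q w] d by (simp add: power2_eq_square)
    finally show "measure lborel C - (measure lborel ?A + measure lborel ?B) \<le> 2 * d * measure lborel C"
      by (simp add: algebra_simps)
  qed
  finally show ?thesis
    using 1 by (simp add: mult_ac)
qed

section \<open>The rotating knife for two agents\<close>

text \<open>Turning the knife by half a turn exchanges the two pieces, so by the intermediate value theorem some
  position makes agent 0 exactly indifferent; agent 1 then chooses.\<close>
lemma exists_envy_free_near_half:
  fixes C :: "point set" and v :: "nat \<Rightarrow> point \<Rightarrow> real"
  assumes C: "compact C" "convex C" "fat R C" and v: "\<And>i. i < 2 \<Longrightarrow> value_density C (v i)"
    and e: "0 < e"
  obtains X where "allocation C 2 {X. convex X \<and> fat (2 * R) X} X"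
    "envy_free {X. convex X \<and> fat (2 * R) X} 2 v X"
    "\<And>i. i < 2 \<Longrightarrow> (1 / 2 - e) * V (v i) C \<le> V (v i) (X i)"
proof -
  define S where "S = {X. convex X \<and> fat (2 * R) X}"
  obtain \<theta> c1 s1 c2 s2 where sq: "0 < s1" "square \<theta> c1 s1 \<subseteq> C" "C \<subseteq> square \<theta> c2 s2" "s2 / s1 \<le> R"
    using C(3) unfolding fat_def by blast
  \<comment> \<open>\<open>q\<close> is the centre of the inner square and \<open>q + w t\<close>
    runs through its inscribed circle. So \<open>w t\<close> never vanishes and
    \<open>q + w t\<close> stays in \<open>C\<close>, as continuity of the pieces' values
    requires.\<close>
  define q where "q = c1 + (s1 / 2) *\<^sub>R (cos \<theta>, sin \<theta>) + (s1 / 2) *\<^sub>R (- sin \<theta>, cos \<theta>)"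
  define w where "w t = (s1 / 2 * cos t) *\<^sub>R (cos \<theta>, sin \<theta>) + (s1 / 2 * sin t) *\<^sub>R (- sin \<theta>, cos \<theta>)" for t
  have w_pi: "w (t + pi) = - w t" for t
    by (simp add: w_def)
  have w0: "w t \<noteq> 0" for t
  proof -
    have norm_rot: "((k * x) *\<^sub>R (a, b) + (k * y) *\<^sub>R (- b, a)) \<bullet> ((k * x) *\<^sub>R (a, b) + (k * y) *\<^sub>R (- b, a))
        = k\<^sup>2 * (x\<^sup>2 + y\<^sup>2) * (a\<^sup>2 + b\<^sup>2)" for k x y a b :: real
      by (simp add: power2_eq_square algebra_simps)
    then have "w t \<bullet> w t = (s1 / 2)\<^sup>2"
      unfolding w_def by (simp only: norm_rot sin_cos_squared_add2 mult_1_right)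
    then show ?thesis using sq by auto
  qed
  have qw: "q + w t \<in> C" for t
  proof -
    have "0 \<le> s1 / 2 * (1 + a) \<and> s1 / 2 * (1 + a) \<le> s1" if "- 1 \<le> a" "a \<le> 1" for a
      using that sq(1) mult_left_mono[of "1 + a" 2 "s1 / 2"] by simp
    from this[of "cos t"] this[of "sin t"]
    have "0 \<le> s1 / 2 * (1 + cos t)" "s1 / 2 * (1 + cos t) \<le> s1"
      "0 \<le> s1 / 2 * (1 + sin t)" "s1 / 2 * (1 + sin t) \<le> s1"
      by simp_all
    moreover have "q + w t = c1 + (s1 / 2 * (1 + cos t)) *\<^sub>R (cos \<theta>, sin \<theta>)
        + (s1 / 2 * (1 + sin t)) *\<^sub>R (- sin \<theta>, cos \<theta>)"
      by (simp add: q_def w_def field_simps)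
    ultimately have "q + w t \<in> square \<theta> c1 s1"
      unfolding square_eq
      by (intro CollectI exI[of _ "s1 / 2 * (1 + cos t)"] exI[of _ "s1 / 2 * (1 + sin t)"]) auto
    then show ?thesis using sq by blast
  qed
  have qw': "q - w t \<in> C" for t
    using qw[of "t + pi"] by (simp add: w_pi)
  have "\<exists>M\<ge>0. \<forall>x\<in>C. v i x \<le> M" if i: "i < 2" for i
  proof -
    obtain B where "\<forall>y\<in>v i ` C. norm y \<le> B"
      using v[OF i] unfolding value_density_def bounded_iff by blast
    then show ?thesis
      by (intro exI[of _ "max B 0"]) force
  qed
  then obtain M where M: "\<And>i. i < 2 \<Longrightarrow> 0 \<le> M i" "\<And>i x. i < 2 \<Longrightarrow> x \<in> C \<Longrightarrow> v i x \<le> M i"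
    by metis
  \<comment> \<open>\<open>K i\<close> measures the bound \<open>M i * measure lborel C\<close> in
    units of agent \<open>i\<close>'s total value. The \<open>d\<close> chosen below satisfies
    \<open>d * K i \<le> e\<close> for both agents, and the summand \<open>2 * e\<close> in its
    denominator forces \<open>d < 1\<close>.\<close>
  define K where "K i = M i * measure lborel C / V (v i) C" for i
  have pos: "0 < V (v i) C" if "i < 2" for i
    using v[OF that] by (simp add: value_density_def)
  have K: "0 \<le> K i" if "i < 2" for i
    using M(1)[OF that] pos[OF that] by (simp add: K_def)
  define d where "d = e / (2 * e + K 0 + K 1)"
  have den: "0 < 2 * e + K 0 + K 1" "e < 2 * e + K 0 + K 1" using K[of 0] K[of 1] e by auto
  have d: "0 < d" "d < 1" using den e by (auto simp: d_def)
  have dK: "d * (M i * measure lborel C) \<le> e * V (v i) C" if "i < 2" for i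
  proof -
    have "K i \<le> 2 * e + K 0 + K 1"
      using that K[of 0] K[of 1] e by (auto simp: less_2_cases_iff)
    then have "d * K i \<le> e"
      using den e by (simp add: d_def divide_simps mult.commute)
    then have "d * K i * V (v i) C \<le> e * V (v i) C"
      using pos[OF that] by (intro mult_right_mono) auto
    then show ?thesis
      using pos[OF that] by (simp add: K_def)
  qed
  let ?P = "shrunk_half C q d"
  have cont_w: "continuous_on A w" for A
    unfolding w_def by (intro continuous_intros)
  have cont: "continuous_on UNIV (\<lambda>t. V (v 0) (?P (w t)))"
    unfolding V_def
    by (rule continuous_on_compose2[OF continuous_on_integral_shrunk_half cont_w])
      (use C d v[of 0] w0 qw in \<open>auto simp: value_density_def\<close>)
  define f where "f t = V (v 0) (?P (w t)) - V (v 0) (?P (w (t + pi)))" for t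
  have contf: "continuous_on {0..pi} f"
    unfolding f_def
    by (intro continuous_on_diff continuous_on_compose2[OF cont] continuous_intros) auto
  \<comment> \<open>After a full turn \<open>w\<close> is back at \<open>w 0\<close>, so
    \<open>f\<close> takes opposite values at the two ends of the interval.\<close>
  have "f pi = - f 0"
    using w_pi[of pi] w_pi[of 0] by (simp add: f_def)
  then have "\<exists>t. f t = 0"
    using IVT'[of f 0 0 pi] IVT2'[of f pi 0 0] contf by (cases "f 0 \<le> 0") auto
  then obtain t where t: "V (v 0) (?P (w t)) = V (v 0) (?P (- w t))"
    by (auto simp: f_def w_pi)
  \<comment> \<open>\<open>b\<close> records that agent 1 weakly prefers the piece of
    \<open>- w t\<close>. The test \<open>(i = 0) = b\<close> hands agent 1 the preferred piece and
    agent 0 the other one.\<close>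
  define b where "b \<longleftrightarrow> V (v 1) (?P (w t)) \<le> V (v 1) (?P (- w t))"
  define X where "X i = ?P (if (i = 0) = b then w t else - w t)" for i :: nat
  have meas: "?P u \<in> sets borel" for u
    using C compact_shrunk_half by (blast intro: borel_compact)
  have sub: "?P (w t) \<subseteq> C" "?P (- w t) \<subseteq> C"
    using shrunk_half_subset[OF C(2)] qw[of t] qw'[of t] d by auto
  have inS: "?P u \<in> S" for u
    unfolding S_def using C sq d convex_shrunk_half fat_shrunk_half[OF _ _ _ _ _ _ q_def] by blast
  have disj: "?P (w t) \<inter> ?P (- w t) = {}"
    using w0 d by (intro disjoint_shrunk_half)
  have "S \<subseteq> sets borel" by (auto simp: S_def fat_def)
  then have VS: "VS S (v i) (X j) = V (v i) (X j)" if "i < 2" for i j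
    using that sub inS by (intro VS_self[OF v]) (auto simp: X_def)
  have "allocation C 2 S X"
    using disj sub inS by (auto simp: allocation_def X_def less_2_cases_iff)
  moreover have no_envy: "V (v i) (X j) \<le> V (v i) (X i)" if "i < 2" "j < 2" for i j
    using that t by (auto simp: X_def less_2_cases_iff b_def)
  then have "envy_free S 2 v X"
    unfolding envy_free_def by (auto simp: VS)
  moreover have "(1 / 2 - e) * V (v i) C \<le> V (v i) (X i)" if "i < 2" for i
  proof -
    \<comment> \<open>Without envy, an agent's own piece is worth at least half of both pieces
      together. Half of the total loss is \<open>d * (M i * measure lborel C)\<close>, which
      \<open>dK\<close> bounds by \<open>e * V (v i) C\<close>.\<close>
    have "V (v i) C - 2 * d * (M i * measure lborel C) \<le> V (v i) (?P (w t)) + V (v i) (?P (- w t))"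
      using that v C w0 qw qw' d M by (intro V_two_shrunk_halves_ge) auto
    also have "\<dots> = V (v i) (X 0) + V (v i) (X 1)"
      by (simp add: X_def)
    also have "\<dots> \<le> 2 * V (v i) (X i)"
      using no_envy[OF that, of 0] no_envy[OF that, of 1] by simp
    finally show ?thesis
      using dK[OF that] by (simp add: algebra_simps)
  qed
  ultimately show ?thesis
    using that unfolding S_def by blast
qed

section \<open>Positive area of a fat set and the two bounds on \<open>PropEF\<close>\<close>

text \<open>By Cauchy-Schwarz the coordinates of \<open>z - ?q\<close> in the orthonormal frame are
  at most its norm, so they stay below half the side.\<close>

lemma ball_subset_square:
  "ball (c + (s / 2) *\<^sub>R (cos \<theta>, sin \<theta>) + (s / 2) *\<^sub>R (- sin \<theta>, cos \<theta>)) (s / 2) \<subseteq> square \<theta> c s"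
    (is "ball ?q _ \<subseteq> _")
proof
  let ?e = "(cos \<theta>, sin \<theta>)" and ?f = "(- sin \<theta>, cos \<theta>)"
  fix z assume "z \<in> ball ?q (s / 2)"
  then have nz: "norm (z - ?q) < s / 2"
    by (simp add: dist_norm norm_minus_commute)
  define x where "x = (z - ?q) \<bullet> ?e"
  define y where "y = (z - ?q) \<bullet> ?f"
  have "norm ?e = 1" "norm ?f = 1" by (simp_all add: norm_Pair)
  then have "\<bar>x\<bar> < s / 2" "\<bar>y\<bar> < s / 2"
    using Cauchy_Schwarz_ineq2[of "z - ?q" ?e] Cauchy_Schwarz_ineq2[of "z - ?q" ?f] nz
    unfolding x_def y_def by auto
  moreover obtain u v where uv: "z - ?q = (u, v)"
    by (cases "z - ?q")
  have xy: "x = u * cos \<theta> + v * sin \<theta>" "y = v * cos \<theta> - u * sin \<theta>"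
    unfolding x_def y_def uv by simp_all
  \<comment> \<open>Purely algebraic expansion of a vector in the frame; the factor
    \<open>a\<^sup>2 + b\<^sup>2\<close> becomes 1 for cosine and sine.\<close>
  have "(u * a + v * b) * a - (v * a - u * b) * b = u * (a\<^sup>2 + b\<^sup>2)"
    "(u * a + v * b) * b + (v * a - u * b) * a = v * (a\<^sup>2 + b\<^sup>2)" for a b
    by (simp_all add: power2_eq_square algebra_simps)
  from this[of "cos \<theta>" "sin \<theta>"] have "z - ?q = x *\<^sub>R ?e + y *\<^sub>R ?f"
    unfolding uv xy by simp
  then have "z = ?q + (x *\<^sub>R ?e + y *\<^sub>R ?f)"
    by (simp only: diff_eq_eq add.commute)
  then have "z = c + (s / 2 + x) *\<^sub>R ?e + (s / 2 + y) *\<^sub>R ?f"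
    by (simp only: scaleR_add_left) (simp only: add_ac)
  ultimately show "z \<in> square \<theta> c s"
    unfolding square_eq by (intro CollectI exI[of _ "s / 2 + x"] exI[of _ "s / 2 + y"]) auto
qed

text \<open>The inner square contains a nonempty open disc, which is not negligible. This makes the
  uniform density an admissible value density.\<close>

lemma measure_pos_if_fat:
  assumes "fat R C" "compact C"
  shows "0 < measure lborel C"
proof -
  obtain \<theta> c s where s: "0 < s" "square \<theta> c s \<subseteq> C"
    using assms unfolding fat_def by blast
  obtain q where "ball q (s / 2) \<subseteq> C"
    using ball_subset_square s by blast
  moreover have "\<not> negligible (ball q (s / 2))"
    using s by (intro open_not_negligible) auto
  ultimately have "\<not> negligible C"
    using negligible_subset by blast
  then have "measure lebesgue C \<noteq> 0"
    using assms by (simp add: negligible_iff_measure lmeasurable_compact)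
  then have "measure lborel C \<noteq> 0"
    using assms by (simp add: borel_compact)
  then show ?thesis
    by (simp add: zero_less_measure_iff)
qed

theorem mainTheorem19:
  fixes R :: real and C :: "point set"
  assumes "R \<ge> 1" and "compact C" and "convex C" and "fat R C"
  shows "PropEF C 2 {X. convex X \<and> fat (2 * R) X} = ereal (1 / 2)"
proof (rule antisym)
  let ?S = "{X. convex X \<and> fat (2 * R) X}"
  have two: "{..<2} = {0, 1::nat}" by auto
  \<comment> \<open>The uniform density for both agents witnesses the upper bound: two disjoint
    pieces share the area of \<open>C\<close>, so one of them gets at most half.\<close>
  let ?v = "\<lambda>_ _. 1 :: real"
  have "emeasure lborel C < \<infinity>"
    using assms by (intro emeasure_bounded_finite compact_imp_bounded)
  then have "set_integrable lborel C (\<lambda>_. 1 :: real)" "V (\<lambda>_. 1) C = measure lborel C"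
    using assms by (auto simp: set_integrable_def V_def borel_compact set_integral_const)
  then have dens: "value_density C (\<lambda>_. 1)"
    using measure_pos_if_fat assms by (auto simp: value_density_def image_constant_conv)
  then have pos: "0 < V (\<lambda>_. 1) C"
    by (simp add: value_density_def)
  show "PropEF C 2 ?S \<le> ereal (1 / 2)"
    unfolding PropEF_def
  proof (rule INF_lower2[of ?v], goal_cases)
    case 1
    show ?case using dens by simp
  next
    case 2
    show ?case
    proof (rule SUP_least, goal_cases)
      case (1 X)
      then have X: "X 0 \<in> ?S" "X 1 \<in> ?S" "X 0 \<inter> X 1 = {}" "X 0 \<subseteq> C" "X 1 \<subseteq> C"
        by (auto simp: allocation_def less_2_cases_iff)
      then have meas: "X 0 \<in> sets borel" "X 1 \<in> sets borel" "C \<in> sets borel"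
        using assms by (auto simp: fat_def)
      have "V (\<lambda>_. 1) (X 0) + V (\<lambda>_. 1) (X 1) = V (\<lambda>_. 1) (X 0 \<union> X 1)"
        using V_disjoint_Un[OF dens] meas X by simp
      also have "\<dots> \<le> V (\<lambda>_. 1) C"
        using meas X by (intro V_mono[OF dens]) auto
      finally have "V (\<lambda>_. 1) (X 0) / V (\<lambda>_. 1) C + V (\<lambda>_. 1) (X 1) / V (\<lambda>_. 1) C \<le> 1"
        using pos by (simp add: add_divide_distrib[symmetric])
      then have "V (\<lambda>_. 1) (X 0) / V (\<lambda>_. 1) C \<le> 1 / 2 \<or> V (\<lambda>_. 1) (X 1) / V (\<lambda>_. 1) C \<le> 1 / 2"
        by linarith
      then have "Min ((\<lambda>i. V (\<lambda>_. 1) (X i) / V (\<lambda>_. 1) C) ` {..<2}) \<le> 1 / 2"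
        unfolding two by (subst Min_le_iff) blast+
      then show ?case
        by (simp only: ereal_less_eq)
    qed
  qed
  \<comment> \<open>The contracted pieces guarantee each agent only \<open>1 / 2 - e\<close>, so the
    inequality is proved up to an arbitrary positive \<open>e\<close>.\<close>
  show "ereal (1 / 2) \<le> PropEF C 2 ?S"
    unfolding PropEF_def
  proof (rule INF_greatest, rule ereal_le_epsilon2)
    fix v :: "nat \<Rightarrow> point \<Rightarrow> real" and e :: real
    assume "v \<in> {v. \<forall>i<2. value_density C (v i)}" and e: "0 < e"
    then have v: "\<And>i. i < 2 \<Longrightarrow> value_density C (v i)" by auto
    let ?m = "\<lambda>X. ereal (Min ((\<lambda>i. V (v i) (X i) / V (v i) C) ` {..<2}))"
    obtain X where X: "allocation C 2 ?S X" "envy_free ?S 2 v X"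
      "\<And>i. i < 2 \<Longrightarrow> (1 / 2 - e) * V (v i) C \<le> V (v i) (X i)"
      by (rule exists_envy_free_near_half[where v = v, OF assms(2-4) _ e]) (use v in auto)
    have "1 / 2 - e \<le> V (v i) (X i) / V (v i) C" if "i < 2" for i
      using X(3)[OF that] v[OF that] by (simp add: value_density_def pos_le_divide_eq)
    then have "ereal (1 / 2 - e) \<le> ?m X"
      by (simp add: two)
    also have "\<dots> \<le> (SUP X \<in> {X. allocation C 2 ?S X \<and> envy_free ?S 2 v X}. ?m X)"
      using X by (intro SUP_upper) auto
    finally have "ereal (1 / 2 - e) + ereal e
      \<le> (SUP X \<in> {X. allocation C 2 ?S X \<and> envy_free ?S 2 v X}. ?m X) + ereal e"
      by (rule add_right_mono)
    then show "ereal (1 / 2)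
      \<le> (SUP X \<in> {X. allocation C 2 ?S X \<and> envy_free ?S 2 v X}. ?m X) + ereal e"
      by simp
  qed
qed

end
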